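(* Let $k\geqslant 3$. There exist constants $c_1,c_2>0$ depending only on $k$ such that for every prime $N>k$, every $1\leqslant m\leqslant N$ and every $a>0$, \[ \mathbb{P}\big(|D^k(B_m)|>a\big)\leqslant N^{c_1}\exp\left(-c_2\frac{a}{m}\right). \]
   Context: For $N$ prime, a $k$-term arithmetic progression ($k$-progression) in $\mathbb{Z}/N\mathbb{Z}$ is a set $\{x,x+d,\dots,x+(k-1)d\}$ with $x\in\mathbb{Z}/N\mathbb{Z}$ and $d\in\{1,\dots,(N-1)/2\}$. $B_m$ is a uniformly random $m$-element subset of $\mathbb{Z}/N\mathbb{Z}$, $N^k(B_m)$ is the number of $k$-progressions contained in $B_m$, and $D^k(B_m)=N^k(B_m)-\mathbb{E}[N^k(B_m)]$. *)

theory Defs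
  imports "HOL-Probability.Probability" "HOL-Computational_Algebra.Primes"
begin

text \<open>
  The residues modulo \<open>N\<close> are represented by the naturals below \<open>N\<close>, with addition modulo \<open>N\<close>.
\<close>

definition progression :: "nat \<Rightarrow> nat \<Rightarrow> nat \<Rightarrow> nat \<Rightarrow> nat set" where
  "progression N k x d = (\<lambda>i. (x + i * d) mod N) ` {0..<k}"

text \<open>
  Progressions are counted as sets. For \<open>N\<close> prime and \<open>2 \<le> k < N - 1\<close> distinct pairs \<open>(x, d)\<close> give distinct sets,
  but for \<open>k = N - 1\<close> they do not in general.
\<close>

definition progressions :: "nat \<Rightarrow> nat \<Rightarrow> nat set set" where
  "progressions N k =
     {progression N k x d | x d. x \<in> {0..<N} \<and> d \<in> {1..(N - 1) div 2}}"

definition num_progressions :: "nat \<Rightarrow> nat \<Rightarrow> nat set \<Rightarrow> nat" where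
  "num_progressions N k B = card {P \<in> progressions N k. P \<subseteq> B}"

text \<open>Only meaningful for \<open>m \<le> N\<close>, when the set sampled from is nonempty.\<close>

definition random_subset :: "nat \<Rightarrow> nat \<Rightarrow> nat set pmf" where
  "random_subset N m = pmf_of_set {B. B \<subseteq> {0..<N} \<and> card B = m}"

definition deviation :: "nat \<Rightarrow> nat \<Rightarrow> nat \<Rightarrow> nat set \<Rightarrow> real" where
  "deviation N k m B =
     real (num_progressions N k B) -
     measure_pmf.expectation (random_subset N m) (\<lambda>B'. real (num_progressions N k B'))"

end

theory Submission
  imports Defs "HOL-Probability.Hoeffding"
begin

text \<open>
  Draw the random set one element at a time and let \<open>f\<close> count progressions. The next increment of the
  Doob martingale of \<open>f\<close> ranges over an interval whose length is, by swapping the new element, at most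
  a conditional mean of \<open>\<psi> S = f (S \<union> {b}) - f (S \<union> {b'})\<close> for some \<open>b\<close>, \<open>b'\<close>. Two distinct points lie in
  at most \<open>k\<^sup>2\<close> common progressions, so \<open>\<psi>\<close> changes by \<open>O(k\<^sup>2)\<close> when one element of \<open>S\<close> is replaced, and
  the reflection exchanging \<open>b\<close> and \<open>b'\<close> shows that \<open>\<psi>\<close> has mean \<open>0\<close>. Hence \<open>\<psi>\<close> is subgaussian with
  variance proxy \<open>O(m)\<close> and \<open>exp (c * \<psi>\<^sup>2 / m)\<close> has polynomially bounded mean. By Hoeffding's lemma
  and Cauchy--Schwarz the square of the mean of \<open>exp (\<mu> / 2 * (f - E f))\<close> is at most the mean of
  \<open>exp (\<mu>\<^sup>2 / 8 * W)\<close>, where \<open>W\<close> is the sum of the \<open>m\<close> squared ranges. For \<open>\<mu>\<close> of order \<open>1 / m\<close> this is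
  polynomial in \<open>N\<close>, after a union bound over the draws and over \<open>b\<close>, \<open>b'\<close>; Markov's inequality concludes.
\<close>

subsection \<open>Averages and sampling without replacement\<close>

definition avg :: "'a set \<Rightarrow> ('a \<Rightarrow> real) \<Rightarrow> real" where
  "avg A g = (\<Sum>x\<in>A. g x) / real (card A)"

lemma avg_mono:
  assumes "\<And>x. x \<in> A \<Longrightarrow> g x \<le> h x"
  shows "avg A g \<le> avg A h"
  unfolding avg_def by (intro divide_right_mono sum_mono assms) auto

lemma avg_cong: "(\<And>x. x \<in> A \<Longrightarrow> g x = h x) \<Longrightarrow> avg A g = avg A h"
  unfolding avg_def by simp

lemma avg_const: "finite A \<Longrightarrow> A \<noteq> {} \<Longrightarrow> avg A (\<lambda>_. c) = c"
  unfolding avg_def by simp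

lemma avg_nonneg: "(\<And>x. x \<in> A \<Longrightarrow> 0 \<le> g x) \<Longrightarrow> 0 \<le> avg A g"
  unfolding avg_def by (simp add: sum_nonneg)

lemma avg_add: "avg A (\<lambda>x. g x + h x) = avg A g + avg A h"
  unfolding avg_def by (simp add: sum.distrib add_divide_distrib)

lemma avg_diff: "avg A (\<lambda>x. g x - h x) = avg A g - avg A h"
  unfolding avg_def by (simp add: sum_subtractf diff_divide_distrib)

lemma avg_mult: "avg A (\<lambda>x. c * g x) = c * avg A g"
  unfolding avg_def by (simp add: sum_distrib_left)

lemma avg_sum: "avg A (\<lambda>x. \<Sum>i\<in>I. g i x) = (\<Sum>i\<in>I. avg A (g i))"
  unfolding avg_def by (subst sum.swap) (simp add: sum_divide_distrib)

lemma avg_convex: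
  assumes "finite A" "A \<noteq> {}" "convex_on UNIV \<Phi>"
  shows "\<Phi> (avg A g) \<le> avg A (\<lambda>x. \<Phi> (g x))"
proof -
  have "\<Phi> (\<Sum>x\<in>A. (1 / real (card A)) *\<^sub>R g x) \<le> (\<Sum>x\<in>A. (1 / real (card A)) * \<Phi> (g x))"
    by (rule convex_on_sum) (use assms in auto)
  then show ?thesis
    by (simp add: avg_def flip: sum_divide_distrib)
qed

text \<open>Stating the pointwise bound as \<open>u\<^sup>2 \<le> p * q\<close> matches the shape of
  an inductive bound on a squared conditional mean.\<close>

lemma avg_Cauchy_Schwarz:
  assumes "\<And>x. x \<in> A \<Longrightarrow> 0 \<le> u x" "\<And>x. x \<in> A \<Longrightarrow> 0 \<le> p x" "\<And>x. x \<in> A \<Longrightarrow> 0 \<le> q x"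
    and "\<And>x. x \<in> A \<Longrightarrow> (u x)\<^sup>2 \<le> p x * q x"
  shows "(avg A u)\<^sup>2 \<le> avg A p * avg A q"
proof -
  have u: "u x \<le> sqrt (p x) * sqrt (q x)" if "x \<in> A" for x
    using assms(4)[OF that] by (metis real_le_rsqrt real_sqrt_mult)
  have "(\<Sum>x\<in>A. u x)\<^sup>2 \<le> (\<Sum>x\<in>A. sqrt (p x) * sqrt (q x))\<^sup>2"
    by (intro power_mono sum_mono sum_nonneg u assms)
  also have "\<dots> \<le> (\<Sum>x\<in>A. (sqrt (p x))\<^sup>2) * (\<Sum>x\<in>A. (sqrt (q x))\<^sup>2)"
    by (rule Cauchy_Schwarz_ineq_sum)
  also have "\<dots> = (\<Sum>x\<in>A. p x) * (\<Sum>x\<in>A. q x)"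
    using assms by simp
  finally show ?thesis
    unfolding avg_def by (simp add: power_divide power2_eq_square divide_right_mono)
qed

lemma avg_exp_le_Hoeffding:
  assumes "finite A" "A \<noteq> {}"
    and diff: "\<And>x y. x \<in> A \<Longrightarrow> y \<in> A \<Longrightarrow> \<bar>g x - g y\<bar> \<le> w"
  shows "avg A (\<lambda>x. exp (l * g x)) \<le> exp (l * avg A g + l\<^sup>2 * w\<^sup>2 / 8)"
proof -
  define h where "h x = l * g x" for x
  \<comment> \<open>A bound on pairwise differences places all values in an interval of that length
    starting at the minimum, as Hoeffding's lemma requires.\<close>
  define a where "a = Min (h ` A)"
  define W where "W = \<bar>l\<bar> * w"
  have in_int: "h x \<in> {a..a + W}" if "x \<in> A" for x
  proof -
    have "a \<in> h ` A" unfolding a_def using assms by (intro Min_in) auto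
    then obtain y where y: "y \<in> A" "a = h y" by auto
    have "a \<le> h x" unfolding a_def using assms that by auto
    moreover have "\<bar>h x - h y\<bar> \<le> W"
      using diff[OF that y(1)] unfolding h_def W_def
      by (simp add: abs_mult mult_left_mono flip: right_diff_distrib)
    ultimately show ?thesis using y by auto
  qed
  interpret P: interval_bounded_random_variable "measure_pmf (pmf_of_set A)" h a "a + W"
    by unfold_locales (use assms in_int in \<open>auto simp: AE_measure_pmf_iff\<close>)
  have avg: "measure_pmf.expectation (pmf_of_set A) F = avg A F" for F :: "'a \<Rightarrow> real"
    using assms by (simp add: integral_pmf_of_set avg_def)
  have int: "integrable (measure_pmf (pmf_of_set A)) F" for F :: "'a \<Rightarrow> real"
    by (rule integrable_measure_pmf_finite) (use assms in simp)
  have "(\<integral>\<^sup>+x. ennreal (exp (1 * (h x - avg A h))) \<partial>measure_pmf (pmf_of_set A))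
          \<le> ennreal (exp (1\<^sup>2 * (a + W - a)\<^sup>2 / 8))"
    using P.Hoeffdings_lemma_nn_integral[of 1] by (simp add: avg)
  then have "ennreal (avg A (\<lambda>x. exp (h x - avg A h))) \<le> ennreal (exp (W\<^sup>2 / 8))"
    by (subst (asm) nn_integral_eq_integral) (auto simp: int avg)
  then have *: "avg A (\<lambda>x. exp (h x - avg A h)) \<le> exp (W\<^sup>2 / 8)"
    by (simp add: ennreal_le_iff)
  have "avg A (\<lambda>x. exp (l * g x)) = exp (avg A h) * avg A (\<lambda>x. exp (h x - avg A h))"
    by (simp add: h_def exp_add[symmetric] flip: avg_mult)
  also have "\<dots> \<le> exp (avg A h) * exp (W\<^sup>2 / 8)"
    using * by simp
  also have "\<dots> = exp (l * avg A g + l\<^sup>2 * w\<^sup>2 / 8)"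
    by (simp add: h_def [abs_def] avg_mult W_def power_mult_distrib exp_add)
  finally show ?thesis .
qed

text \<open>
  The mean of \<open>g (B \<union> R)\<close> over a uniformly random \<open>j\<close>-element subset \<open>R\<close> of \<open>V - B\<close>, drawn one
  element at a time. It is \<open>0\<close> when \<open>j > card (V - B)\<close> because an average over the empty set is \<open>0\<close>.
\<close>

primrec smean :: "'a set \<Rightarrow> nat \<Rightarrow> ('a set \<Rightarrow> real) \<Rightarrow> 'a set \<Rightarrow> real" where
  "smean V 0 g B = g B"
| "smean V (Suc j) g B = avg (V - B) (\<lambda>b. smean V j g (insert b B))"

lemma card_Diff_insert_eq: "finite V \<Longrightarrow> b \<in> V - B \<Longrightarrow> card (V - insert b B) = card (V - B) - 1"
  by (metis Diff_insert card_Diff_singleton)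

lemma smean_mono:
  assumes "finite V" "finite B"
    and "\<And>S. B \<subseteq> S \<Longrightarrow> S \<subseteq> B \<union> V \<Longrightarrow> card S = card B + j \<Longrightarrow> g S \<le> h S"
  shows "smean V j g B \<le> smean V j h B"
  using assms(2,3)
proof (induction j arbitrary: B)
  case 0
  then show ?case by simp
next
  case (Suc j)
  show ?case
    unfolding smean.simps
  proof (rule avg_mono)
    fix b assume b: "b \<in> V - B"
    show "smean V j g (insert b B) \<le> smean V j h (insert b B)"
      by (rule Suc.IH) (use Suc.prems b in auto)
  qed
qed

lemma smean_nonneg:
  assumes "\<And>S. 0 \<le> g S"
  shows "0 \<le> smean V j g B"
  by (induction j arbitrary: B) (auto intro: avg_nonneg assms)

lemma smean_add: "smean V j (\<lambda>S. g S + h S) B = smean V j g B + smean V j h B"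
  by (induction j arbitrary: B) (auto simp: avg_add)

lemma smean_mult: "smean V j (\<lambda>S. c * g S) B = c * smean V j g B"
  by (induction j arbitrary: B) (auto simp: avg_mult)

lemma smean_sum: "smean V j (\<lambda>S. \<Sum>i\<in>I. g i S) B = (\<Sum>i\<in>I. smean V j (g i) B)"
  by (induction j arbitrary: B) (auto simp: avg_sum)

lemma smean_smean: "smean V i (smean V j g) B = smean V (i + j) g B"
  by (induction i arbitrary: B) auto

text \<open>Only an inequality: once the points of \<open>V\<close> are exhausted, the average over
  the empty set is \<open>0\<close>.\<close>

lemma smean_const_le: "0 \<le> c \<Longrightarrow> smean V j (\<lambda>_. c) B \<le> c"
proof (induction j arbitrary: B)
  case (Suc j)
  have "smean V (Suc j) (\<lambda>_. c) B \<le> avg (V - B) (\<lambda>_. c)"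
    unfolding smean.simps by (intro avg_mono Suc)
  also have "\<dots> \<le> c" using Suc.prems by (simp add: avg_def)
  finally show ?case .
qed simp

lemma smean_bounds:
  assumes "finite V" "finite B" "0 \<le> c"
    and bd: "\<And>S. B \<subseteq> S \<Longrightarrow> S \<subseteq> B \<union> V \<Longrightarrow> card S = card B + j \<Longrightarrow> \<bar>g S\<bar> \<le> c"
  shows "\<bar>smean V j g B\<bar> \<le> c"
proof -
  have "g S \<le> c" "- c \<le> g S" if "B \<subseteq> S" "S \<subseteq> B \<union> V" "card S = card B + j" for S
    using bd[OF that] by linarith+
  then have "smean V j g B \<le> smean V j (\<lambda>_. c) B" "smean V j (\<lambda>_. - c) B \<le> smean V j g B"
    using assms(1,2) by (intro smean_mono; simp)+
  moreover have "smean V j (\<lambda>_. - c) B = - smean V j (\<lambda>_. c) B"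
    using smean_mult[of V j "-1" "\<lambda>_. c" B] by simp
  ultimately show ?thesis using smean_const_le[OF assms(3), of V j B] by linarith
qed

text \<open>Jensen's inequality at every draw. The bound on \<open>j\<close> keeps each average over
  a nonempty set; with the default value \<open>0\<close> the inequality would fail for
  \<open>\<Phi> 0 > 0\<close>.\<close>

lemma smean_convex:
  assumes "finite V" "convex_on UNIV \<Phi>" "j \<le> card (V - B)"
  shows "\<Phi> (smean V j g B) \<le> smean V j (\<lambda>S. \<Phi> (g S)) B"
  using assms(3)
proof (induction j arbitrary: B)
  case (Suc j)
  have "V - B \<noteq> {}" using Suc.prems by force
  then have "\<Phi> (smean V (Suc j) g B) \<le> avg (V - B) (\<lambda>b. \<Phi> (smean V j g (insert b B)))"
    unfolding smean.simps by (intro avg_convex) (use assms in auto)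
  also have "\<dots> \<le> avg (V - B) (\<lambda>b. smean V j (\<lambda>S. \<Phi> (g S)) (insert b B))"
    by (intro avg_mono Suc.IH) (use Suc.prems assms in \<open>simp add: card_Diff_insert_eq\<close>)
  finally show ?case by simp
qed simp

lemma smean_image:
  assumes "inj_on \<pi> V" "B \<subseteq> V"
  shows "smean (\<pi> ` V) j g (\<pi> ` B) = smean V j (\<lambda>S. g (\<pi> ` S)) B"
  using assms(2)
proof (induction j arbitrary: B)
  case (Suc j)
  have inj: "inj_on \<pi> (V - B)" using assms(1) by (rule inj_on_subset) auto
  have "\<pi> ` V - \<pi> ` B = \<pi> ` (V - B)"
    using assms(1) Suc.prems by (metis Diff_subset inj_on_image_set_diff)
  then have "smean (\<pi> ` V) (Suc j) g (\<pi> ` B) =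
      avg (V - B) (\<lambda>b. smean (\<pi> ` V) j g (\<pi> ` insert b B))"
    using inj by (simp add: avg_def sum.reindex card_image)
  also have "\<dots> = avg (V - B) (\<lambda>b. smean V j (\<lambda>S. g (\<pi> ` S)) (insert b B))"
    by (intro avg_cong Suc.IH) (use Suc.prems in auto)
  finally show ?case by simp
qed simp

lemma smean_cong:
  assumes "finite V" "finite B"
    and "\<And>S. B \<subseteq> S \<Longrightarrow> S \<subseteq> B \<union> V \<Longrightarrow> card S = card B + j \<Longrightarrow> g S = h S"
  shows "smean V j g B = smean V j h B"
  by (intro antisym smean_mono) (use assms in auto)

text \<open>
  Restricting the sample space to avoid the points of \<open>X\<close> can only increase the mean, since it
  amounts to conditioning on the support of the integrand.
\<close>

lemma smean_avoid_le:
  assumes "finite V" "\<And>S. 0 \<le> g S"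
  shows "smean V j (\<lambda>S. if S \<inter> X = {} then g S else 0) B \<le> smean (V - X) j g B"
proof (induction j arbitrary: B)
  case 0
  then show ?case using assms by simp
next
  case (Suc j)
  let ?h = "\<lambda>S. if S \<inter> X = {} then g S else 0"
  \<comment> \<open>A sample that has met \<open>X\<close> keeps meeting it, so the integrand
    vanishes on all its extensions.\<close>
  have zero: "smean V i ?h C = 0" if "C \<inter> X \<noteq> {}" for i C
    using that
  proof (induction i arbitrary: C)
    case (Suc i)
    have "smean V i ?h (insert b C) = 0" for b
      by (rule Suc.IH) (use Suc.prems in auto)
    then show ?case by (simp add: avg_def)
  qed auto
  have "(\<Sum>b\<in>V - B. smean V j ?h (insert b B)) = (\<Sum>b\<in>V - X - B. smean V j ?h (insert b B))"
    by (rule sum.mono_neutral_right) (use assms in \<open>auto intro!: zero\<close>)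
  also have "\<dots> \<le> (\<Sum>b\<in>V - X - B. smean (V - X) j g (insert b B))"
    by (intro sum_mono Suc.IH)
  finally have le: "(\<Sum>b\<in>V - B. smean V j ?h (insert b B)) \<le> (\<Sum>b\<in>V - X - B. smean (V - X) j g (insert b B))" .
  show ?case
  proof (cases "V - X - B = {}")
    case True
    show ?thesis
      using le unfolding True smean.simps avg_def by (simp add: divide_nonpos_nonneg)
  next
    case False
    have "card (V - X - B) \<le> card (V - B)" by (rule card_mono) (use assms in auto)
    moreover have "card (V - X - B) > 0" using False assms by (simp add: card_gt_0_iff)
    ultimately show ?thesis unfolding smean.simps avg_def
      using le by (intro frac_le) (auto intro!: sum_nonneg smean_nonneg assms)
  qed
qed

section \<open>Exchanging one element of the sample\<close>

text \<open>Samples that contain the other point yield the same sets from either start and cancel.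
  The remaining ones avoid both points: the prefactor is their probability, and given this they are
  uniform samples from \<open>V - {b, b'}\<close>.\<close>

lemma smean_swap:
  assumes "finite V" "b \<in> V" "b' \<in> V" "b \<noteq> b'" "b \<notin> B" "b' \<notin> B" "Suc j \<le> card (V - B)"
  shows "smean V j f (insert b B) - smean V j f (insert b' B) =
    (real (card (V - B)) - 1 - real j) / (real (card (V - B)) - 1) *
      smean (V - {b, b'}) j (\<lambda>S. f (insert b S) - f (insert b' S)) B"
  using assms(5-)
proof (induction j arbitrary: B)
  case 0
  have "card {b, b'} \<le> card (V - B)" by (rule card_mono) (use assms 0 in auto)
  then show ?case using \<open>b \<noteq> b'\<close> by simp
next
  case (Suc j)
  define U where "U = V - {b, b'} - B"
  define n where "n = card (V - B)"
  let ?\<psi> = "\<lambda>S. f (insert b S) - f (insert b' S)"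
  have fin: "finite U" using assms by (simp add: U_def)
  have VB: "V - B = insert b (insert b' U)" "b \<notin> U" "b' \<notin> U"
    using assms Suc.prems by (auto simp: U_def)
  have cU: "n = card U + 2" and n2: "n \<ge> j + 2"
    using VB fin \<open>b \<noteq> b'\<close> Suc.prems by (auto simp: n_def)
  have Vb: "V - insert b B = insert b' U" "V - insert b' B = insert b U"
    using VB \<open>b \<noteq> b'\<close> Suc.prems by auto
  \<comment> \<open>After a draw \<open>c\<close> from \<open>U\<close>, there are
    \<open>card U + 1\<close> points left outside \<open>insert c B\<close>, so the inductive
    prefactor has denominator \<open>card U\<close>; this later cancels against the average over
    \<open>U\<close>.\<close>
  have step: "smean V j f (insert c (insert b B)) - smean V j f (insert c (insert b' B)) =
      (real (card U) - real j) / real (card U) * smean (V - {b, b'}) j ?\<psi> (insert c B)" if "c \<in> U" for c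
  proof -
    have c: "c \<in> V - B" "c \<noteq> b" "c \<noteq> b'" using that by (auto simp: U_def)
    then have card: "card (V - insert c B) = Suc (card U)"
      using assms cU by (simp add: card_Diff_insert_eq n_def)
    show ?thesis
      using Suc.IH[of "insert c B"] Suc.prems c n2 cU unfolding card
      by (simp add: insert_commute)
  qed
  \<comment> \<open>Drawing \<open>b'\<close> after \<open>b\<close> and drawing \<open>b\<close>
    after \<open>b'\<close> lead to the same set, so only draws from \<open>U\<close> survive the
    subtraction.\<close>
  have "smean V (Suc j) f (insert b B) - smean V (Suc j) f (insert b' B) =
      (\<Sum>c\<in>U. smean V j f (insert c (insert b B)) - smean V j f (insert c (insert b' B))) / (real n - 1)"
    using fin VB(2,3) cU by (simp add: Vb avg_def insert_commute sum_subtractf flip: diff_divide_distrib)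
  also have "\<dots> = ((real (card U) - real j) / real (card U)) * (\<Sum>c\<in>U. smean (V - {b, b'}) j ?\<psi> (insert c B)) / (real n - 1)"
    by (simp add: step sum_distrib_left)
  also have "\<dots> = (real (card U) - real j) / (real n - 1) * smean (V - {b, b'}) (Suc j) ?\<psi> B"
    by (simp add: avg_def flip: U_def)
  finally show ?case using cU by (simp add: n_def)
qed

corollary abs_smean_swap_le:
  assumes "finite V" "b \<in> V" "b' \<in> V" "b \<noteq> b'" "b \<notin> B" "b' \<notin> B" "Suc j \<le> card (V - B)"
  shows "\<bar>smean V j f (insert b B) - smean V j f (insert b' B)\<bar> \<le>
      \<bar>smean (V - {b, b'}) j (\<lambda>S. f (insert b S) - f (insert b' S)) B\<bar>"
proof -
  define \<theta> where "\<theta> = (real (card (V - B)) - 1 - real j) / (real (card (V - B)) - 1)"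
  have "0 \<le> \<theta>" "\<theta> \<le> 1" using assms by (auto simp: \<theta>_def divide_simps)
  then show ?thesis
    unfolding smean_swap[OF assms] \<theta>_def[symmetric] abs_mult
    by (simp add: mult_left_le_one_le)
qed

section \<open>Sequential draws and uniformly random subsets\<close>

text \<open>Double counting of the pairs of a \<open>Suc j\<close>-element set and one of its
  elements.\<close>

lemma sum_insert_subsets:
  assumes "finite U"
  shows "(\<Sum>b\<in>U. \<Sum>R | R \<subseteq> U - {b} \<and> card R = j. h (insert b R)) =
         real (Suc j) * (\<Sum>R | R \<subseteq> U \<and> card R = Suc j. h R)"
proof -
  have "(\<Sum>b\<in>U. \<Sum>R | R \<subseteq> U - {b} \<and> card R = j. h (insert b R)) =
      (\<Sum>(b, R) \<in> Sigma U (\<lambda>b. {R. R \<subseteq> U - {b} \<and> card R = j}). h (insert b R))"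
    by (rule sum.Sigma) (use assms in auto)
  also have "\<dots> = (\<Sum>(R, b) \<in> Sigma {R. R \<subseteq> U \<and> card R = Suc j} (\<lambda>R. R). h R)"
    using assms
    by (intro sum.reindex_bij_witness[of _ "\<lambda>(R, b). (b, R - {b})" "\<lambda>(b, R). (insert b R, b)"])
       (auto simp: card_Diff_singleton insert_absorb finite_subset subset_Diff_insert card_insert_if)
  also have "\<dots> = (\<Sum>R | R \<subseteq> U \<and> card R = Suc j. \<Sum>b\<in>R. h R)"
    by (rule sum.Sigma[symmetric]) (use assms finite_subset in auto)
  also have "\<dots> = real (Suc j) * (\<Sum>R | R \<subseteq> U \<and> card R = Suc j. h R)"
    by (subst sum_distrib_left, rule sum.cong) auto
  finally show ?thesis .
qed

text \<open>A set of \<open>Suc j\<close> elements is reached once for each choice of its first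
  element; the absorption identity for binomial coefficients then gives the normalisation.\<close>

lemma smean_eq_sum:
  assumes "finite V"
  shows "smean V j g B = (\<Sum>R | R \<subseteq> V - B \<and> card R = j. g (B \<union> R)) / real (card (V - B) choose j)"
proof (induction j arbitrary: B)
  case 0
  have "{R. R \<subseteq> V - B \<and> card R = 0} = {{}}" using assms finite_subset by fastforce
  then show ?case by simp
next
  case (Suc j)
  define U where "U = V - B"
  have fin: "finite U" using assms by (simp add: U_def)
  have "smean V (Suc j) g B = avg U (\<lambda>b. (\<Sum>R | R \<subseteq> U - {b} \<and> card R = j. g (B \<union> insert b R)) / real (card U - 1 choose j))"
    unfolding smean.simps U_def[symmetric]
  proof (rule avg_cong)
    fix b assume b: "b \<in> U"
    have "V - insert b B = U - {b}" by (auto simp: U_def)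
    then show "smean V j g (insert b B) = (\<Sum>R | R \<subseteq> U - {b} \<and> card R = j. g (B \<union> insert b R)) / real (card U - 1 choose j)"
      using b by (simp add: Suc.IH)
  qed
  also have "\<dots> = (\<Sum>b\<in>U. \<Sum>R | R \<subseteq> U - {b} \<and> card R = j. g (B \<union> insert b R)) / real (card U * (card U - 1 choose j))"
    by (simp add: avg_def flip: sum_divide_distrib)
  also have "\<dots> = real (Suc j) * (\<Sum>R | R \<subseteq> U \<and> card R = Suc j. g (B \<union> R)) / real (Suc j * (card U choose Suc j))"
    using binomial_absorption[of j "card U"] sum_insert_subsets[OF fin, of "\<lambda>R. g (B \<union> R)" j]
    by (simp only:)
  also have "\<dots> = (\<Sum>R | R \<subseteq> U \<and> card R = Suc j. g (B \<union> R)) / real (card U choose Suc j)"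
    by (simp only: of_nat_mult) (simp del: of_nat_Suc)
  finally show ?case unfolding U_def .
qed

lemma expectation_subsets_eq_smean:
  assumes "finite V" "m \<le> card V"
  shows "measure_pmf.expectation (pmf_of_set {B. B \<subseteq> V \<and> card B = m}) g = smean V m g {}"
proof -
  have "{B. B \<subseteq> V \<and> card B = m} \<noteq> {}" using obtain_subset_with_card_n[OF assms(2)] by blast
  then show ?thesis using assms
    by (simp add: integral_pmf_of_set smean_eq_sum n_subsets)
qed

subsection \<open>Concentration from second differences\<close>

text \<open>By the swap formula the Lipschitz constant of \<open>f\<close> passes to its conditional
  means, so it bounds the range of each increment of the Doob martingale.\<close>

lemma smean_Lipschitz:
  assumes "finite V" "B \<subseteq> V" "0 \<le> L" "b \<in> V - B" "b' \<in> V - B" "Suc j \<le> card (V - B)"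
    and lip: "\<And>S b b'. S \<subseteq> V \<Longrightarrow> b \<in> V - S \<Longrightarrow> b' \<in> V - S \<Longrightarrow> \<bar>f (insert b S) - f (insert b' S)\<bar> \<le> L"
  shows "\<bar>smean V j f (insert b B) - smean V j f (insert b' B)\<bar> \<le> L"
proof (cases "b = b'")
  case False
  then have "\<bar>smean V j f (insert b B) - smean V j f (insert b' B)\<bar> \<le>
      \<bar>smean (V - {b, b'}) j (\<lambda>S. f (insert b S) - f (insert b' S)) B\<bar>"
    using assms by (intro abs_smean_swap_le) auto
  also have "\<dots> \<le> L"
    by (rule smean_bounds) (use assms finite_subset in \<open>auto intro!: lip\<close>)
  finally show ?thesis .
qed (use assms in simp)

text \<open>The Azuma--Hoeffding argument: by Hoeffding's lemma each draw costs a factor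
  \<open>exp (l\<^sup>2 * L\<^sup>2 / 8)\<close>.\<close>

lemma smean_exp_le_of_Lipschitz:
  assumes "finite V" "B \<subseteq> V" "0 \<le> L" "j \<le> card (V - B)"
    and lip: "\<And>S b b'. S \<subseteq> V \<Longrightarrow> b \<in> V - S \<Longrightarrow> b' \<in> V - S \<Longrightarrow> \<bar>f (insert b S) - f (insert b' S)\<bar> \<le> L"
  shows "smean V j (\<lambda>S. exp (l * f S)) B \<le> exp (l * smean V j f B + l\<^sup>2 * L\<^sup>2 / 8 * real j)"
  using assms(2,4)
proof (induction j arbitrary: B)
  case (Suc j)
  let ?F = "\<lambda>b. smean V j f (insert b B)"
  have ne: "V - B \<noteq> {}" using Suc.prems by force
  have "smean V (Suc j) (\<lambda>S. exp (l * f S)) B \<le> avg (V - B) (\<lambda>b. exp (l * ?F b + l\<^sup>2 * L\<^sup>2 / 8 * real j))"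
    unfolding smean.simps
    by (intro avg_mono Suc.IH) (use Suc.prems assms in \<open>auto simp: card_Diff_insert_eq\<close>)
  also have "\<dots> = exp (l\<^sup>2 * L\<^sup>2 / 8 * real j) * avg (V - B) (\<lambda>b. exp (l * ?F b))"
    unfolding avg_mult[symmetric] by (simp add: exp_add mult.commute)
  also have "\<dots> \<le> exp (l\<^sup>2 * L\<^sup>2 / 8 * real j) * exp (l * avg (V - B) ?F + l\<^sup>2 * L\<^sup>2 / 8)"
  proof (intro mult_left_mono avg_exp_le_Hoeffding)
    fix x y assume "x \<in> V - B" "y \<in> V - B"
    then show "\<bar>?F x - ?F y\<bar> \<le> L"
      using Suc.prems by (intro smean_Lipschitz assms(1,3) lip)
  qed (use assms ne in auto)
  also have "\<dots> = exp (l * smean V (Suc j) f B + l\<^sup>2 * L\<^sup>2 / 8 * real (Suc j))"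
    by (simp add: exp_add[symmetric] algebra_simps)
  finally show ?case .
qed simp

text \<open>
  A discrete version of \<open>exp (s * x\<^sup>2) = E (exp (sqrt (2 * s) * G * x))\<close> for a standard Gaussian \<open>G\<close>:
  one of the grid points \<open>n\<close> is within distance \<open>1\<close> of the optimal value \<open>2 * sqrt s * x\<close>.
\<close>

lemma exp_square_le_sum_exp:
  fixes s x :: real and K :: nat
  assumes "0 \<le> s" "2 * sqrt s * \<bar>x\<bar> \<le> real K"
  shows "exp (s * x\<^sup>2) \<le> 2 * (\<Sum>n\<in>{- int K..int K}. exp (- ((real_of_int n)\<^sup>2 / 4)) * exp (real_of_int n * sqrt s * x))"
proof -
  define y where "y = 2 * sqrt s * x"
  define n where "n = \<lfloor>y\<rfloor>"
  have "\<bar>y\<bar> \<le> real K" using assms by (simp add: y_def abs_mult)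
  then have n: "n \<in> {- int K..int K}" unfolding n_def by (auto simp: le_floor_iff floor_le_iff abs_le_iff)
  have "\<bar>y - n\<bar> \<le> 1" unfolding n_def by linarith
  then have "(y - n)\<^sup>2 \<le> 1" using abs_square_le_1 by blast
  moreover have "y\<^sup>2 / 4 = s * x\<^sup>2" using assms by (simp add: y_def power_mult_distrib)
  \<comment> \<open>This is \<open>(y - n)\<^sup>2 / 4 \<le> 1 / 4\<close> expanded, with cross term
    \<open>n * y / 2 = n * sqrt s * x\<close>.\<close>
  ultimately have "s * x\<^sup>2 \<le> 1 / 4 + (- ((real_of_int n)\<^sup>2 / 4) + real_of_int n * sqrt s * x)"
    using assms(1) by (simp add: y_def power2_diff algebra_simps)
  then have "exp (s * x\<^sup>2) \<le> exp (1 / 4) * (exp (- ((real_of_int n)\<^sup>2 / 4)) * exp (real_of_int n * sqrt s * x))"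
    by (simp flip: exp_add)
  also have "\<dots> \<le> 2 * (exp (- ((real_of_int n)\<^sup>2 / 4)) * exp (real_of_int n * sqrt s * x))"
    using exp_bound_half[of "1/4 :: real"] by (intro mult_right_mono) auto
  also have "\<dots> \<le> 2 * (\<Sum>n\<in>{- int K..int K}. exp (- ((real_of_int n)\<^sup>2 / 4)) * exp (real_of_int n * sqrt s * x))"
    using n by (intro mult_left_mono member_le_sum) auto
  finally show ?thesis .
qed

text \<open>Averaging the grid bound leaves exponential moments of \<open>f\<close>. At grid point
  \<open>n\<close> the subgaussian exponent is
  \<open>n\<^sup>2 * s * L\<^sup>2 * j / 8 \<le> n\<^sup>2 / 4\<close>, so the Gaussian weight
  brings each of the \<open>2 * K + 1\<close> terms down to at most \<open>1\<close>.\<close>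

lemma smean_exp_square_le:
  fixes K :: nat
  assumes "finite V" "0 \<le> L" "0 \<le> s" "j \<le> card V"
    and lip: "\<And>S b b'. S \<subseteq> V \<Longrightarrow> b \<in> V - S \<Longrightarrow> b' \<in> V - S \<Longrightarrow> \<bar>f (insert b S) - f (insert b' S)\<bar> \<le> L"
    and mean: "smean V j f {} = 0"
    and bd: "\<And>S. S \<subseteq> V \<Longrightarrow> 2 * sqrt s * \<bar>f S\<bar> \<le> real K"
    and s: "s * L\<^sup>2 * real j \<le> 2"
  shows "smean V j (\<lambda>S. exp (s * (f S)\<^sup>2)) {} \<le> 2 * (2 * real K + 1)"
proof -
  let ?I = "{- int K..int K}"
  have "smean V j (\<lambda>S. exp (s * (f S)\<^sup>2)) {} \<le>
      smean V j (\<lambda>S. 2 * (\<Sum>n\<in>?I. exp (- ((real_of_int n)\<^sup>2 / 4)) * exp (real_of_int n * sqrt s * f S))) {}"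
    by (rule smean_mono) (use assms in \<open>auto intro!: exp_square_le_sum_exp\<close>)
  also have "\<dots> = 2 * (\<Sum>n\<in>?I. exp (- ((real_of_int n)\<^sup>2 / 4)) * smean V j (\<lambda>S. exp (real_of_int n * sqrt s * f S)) {})"
    by (simp only: smean_mult smean_sum)
  also have "\<dots> \<le> 2 * (\<Sum>n\<in>?I. 1)"
  proof (intro mult_left_mono sum_mono)
    fix n :: int
    have "smean V j (\<lambda>S. exp (real_of_int n * sqrt s * f S)) {} \<le> exp ((real_of_int n * sqrt s)\<^sup>2 * L\<^sup>2 / 8 * real j)"
      using smean_exp_le_of_Lipschitz[of V "{}" L j f "real_of_int n * sqrt s", OF assms(1) _ assms(2) _ lip] assms(4)
      by (simp add: mean)
    then have "exp (- ((real_of_int n)\<^sup>2 / 4)) * smean V j (\<lambda>S. exp (real_of_int n * sqrt s * f S)) {} \<le>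
        exp (- ((real_of_int n)\<^sup>2 / 4)) * exp ((real_of_int n * sqrt s)\<^sup>2 * L\<^sup>2 / 8 * real j)"
      by (rule mult_left_mono) simp
    also have "\<dots> = exp ((real_of_int n)\<^sup>2 * (s * L\<^sup>2 * real j / 8 - 1 / 4))"
      using assms(3) by (simp add: exp_add[symmetric] power_mult_distrib algebra_simps)
    also have "\<dots> \<le> exp 0"
      unfolding exp_le_cancel_iff by (rule mult_nonneg_nonpos) (use s in \<open>auto simp: mult_ac\<close>)
    also have "exp 0 = (1 :: real)" by simp
    finally show "exp (- ((real_of_int n)\<^sup>2 / 4)) * smean V j (\<lambda>S. exp (real_of_int n * sqrt s * f S)) {} \<le> 1" .
  qed auto
  also have "\<dots> = 2 * (2 * real K + 1)" by simp
  finally show ?thesis .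
qed

section \<open>Random ranges of the martingale increments\<close>

text \<open>The range of the next increment of the Doob martingale of \<open>f\<close> at
  \<open>B\<close>; here \<open>j\<close> counts the draws that follow the next one.\<close>

definition spread :: "'a set \<Rightarrow> nat \<Rightarrow> ('a set \<Rightarrow> real) \<Rightarrow> 'a set \<Rightarrow> real" where
  "spread V j f B = Max ((\<lambda>(b, b'). \<bar>smean V j f (insert b B) - smean V j f (insert b' B)\<bar>) ` ((V - B) \<times> (V - B)))"

text \<open>
  The exponential moment of \<open>\<kappa>\<close> times the sum of the squared increment ranges of the Doob martingale
  of \<open>f\<close>, along the remaining \<open>j\<close> draws.
\<close>

primrec spread_mgf :: "'a set \<Rightarrow> ('a set \<Rightarrow> real) \<Rightarrow> real \<Rightarrow> nat \<Rightarrow> 'a set \<Rightarrow> real" where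
  "spread_mgf V f \<kappa> 0 B = 1"
| "spread_mgf V f \<kappa> (Suc j) B =
     exp (\<kappa> * (spread V j f B)\<^sup>2) * avg (V - B) (\<lambda>b. spread_mgf V f \<kappa> j (insert b B))"

lemma spread_mgf_nonneg: "0 \<le> spread_mgf V f \<kappa> j B"
  by (induction j arbitrary: B) (auto intro!: mult_nonneg_nonneg avg_nonneg)

lemma le_spread:
  assumes "finite V" "b \<in> V - B" "b' \<in> V - B"
  shows "\<bar>smean V j f (insert b B) - smean V j f (insert b' B)\<bar> \<le> spread V j f B"
  unfolding spread_def using assms by (intro Max_ge) (auto intro!: image_eqI[where x = "(b, b')"])

lemma spread_attained:
  assumes "finite V" "V - B \<noteq> {}"
  obtains b b' where "b \<in> V - B" "b' \<in> V - B"
    "spread V j f B = \<bar>smean V j f (insert b B) - smean V j f (insert b' B)\<bar>"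
proof -
  have "spread V j f B \<in> (\<lambda>(b, b'). \<bar>smean V j f (insert b B) - smean V j f (insert b' B)\<bar>) ` ((V - B) \<times> (V - B))"
    unfolding spread_def using assms by (intro Max_in) auto
  then show ?thesis using that by auto
qed

text \<open>The ranges depend on the sample and cannot leave the mean as constants. At each draw
  Cauchy--Schwarz, with the exponent halved on the left, separates the exponential of the
  conditional mean from the moment of the later ranges; Hoeffding's lemma then contributes the
  current range.\<close>

lemma smean_exp_square_le_spread_mgf:
  assumes "finite V" "j \<le> card (V - B)"
  shows "(smean V j (\<lambda>S. exp (\<mu> / 2 * f S)) B)\<^sup>2 \<le> exp (\<mu> * smean V j f B) * spread_mgf V f (\<mu>\<^sup>2 / 8) j B"
  using assms(2)
proof (induction j arbitrary: B)
  case 0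
  then show ?case by (simp add: power2_eq_square flip: exp_add)
next
  case (Suc j)
  let ?u = "\<lambda>b. smean V j (\<lambda>S. exp (\<mu> / 2 * f S)) (insert b B)"
  let ?F = "\<lambda>b. smean V j f (insert b B)"
  let ?Y = "\<lambda>b. spread_mgf V f (\<mu>\<^sup>2 / 8) j (insert b B)"
  have ne: "V - B \<noteq> {}" using Suc.prems by force
  have "(smean V (Suc j) (\<lambda>S. exp (\<mu> / 2 * f S)) B)\<^sup>2 \<le> avg (V - B) (\<lambda>b. exp (\<mu> * ?F b)) * avg (V - B) ?Y"
    unfolding smean.simps
    by (intro avg_Cauchy_Schwarz smean_nonneg spread_mgf_nonneg Suc.IH)
       (use Suc.prems assms in \<open>auto simp: card_Diff_insert_eq\<close>)
  also have "\<dots> \<le> exp (\<mu> * avg (V - B) ?F + \<mu>\<^sup>2 * (spread V j f B)\<^sup>2 / 8) * avg (V - B) ?Y"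
    by (intro mult_right_mono avg_exp_le_Hoeffding avg_nonneg spread_mgf_nonneg le_spread)
       (use assms ne in auto)
  also have "\<dots> = exp (\<mu> * smean V (Suc j) f B) * spread_mgf V f (\<mu>\<^sup>2 / 8) (Suc j) B"
    by (simp add: exp_add)
  finally show ?case .
qed

text \<open>
  This is the pointwise bound \<open>exp (x\<^sub>1 + \<dots> + x\<^sub>m) \<le> max\<^sub>i exp (m * x\<^sub>i) \<le> \<Sum>\<^sub>i exp (m * x\<^sub>i)\<close>
  for the sum of the squared ranges; \<open>y\<close> stands for the largest of the \<open>m - j\<close> terms already seen.
\<close>

lemma spread_mgf_le_sum:
  assumes "finite V" "0 \<le> \<kappa>" "0 \<le> y" "j \<le> m" "j \<le> card (V - B)"
  shows "exp (real (m - j) * y) * spread_mgf V f \<kappa> j B \<le>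
    exp (real m * y) + (\<Sum>i<j. smean V i (\<lambda>S. exp (real m * \<kappa> * (spread V (j - Suc i) f S)\<^sup>2)) B)"
  using assms(3-)
proof (induction j arbitrary: B y)
  case (Suc j)
  define x where "x = \<kappa> * (spread V j f B)\<^sup>2"
  define y' where "y' = max y x"
  let ?Y = "\<lambda>b. spread_mgf V f \<kappa> j (insert b B)"
  let ?g = "\<lambda>j i S. exp (real m * \<kappa> * (spread V (j - Suc i) f S)\<^sup>2)"
  have x0: "0 \<le> x" using assms by (simp add: x_def)
  have ne: "V - B \<noteq> {}" using Suc.prems by force
  have "real (m - Suc j) * y + x \<le> real (m - Suc j) * y' + y'"
    by (intro add_mono mult_left_mono) (auto simp: y'_def)
  also have "\<dots> = real (m - j) * y'"
    using Suc.prems by (simp add: of_nat_diff algebra_simps)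
  finally have "exp (real (m - Suc j) * y) * spread_mgf V f \<kappa> (Suc j) B \<le>
      exp (real (m - j) * y') * avg (V - B) ?Y"
    by (auto simp: x_def[symmetric] mult.assoc[symmetric] exp_add[symmetric]
        intro!: mult_right_mono avg_nonneg spread_mgf_nonneg)
  also have "\<dots> = avg (V - B) (\<lambda>b. exp (real (m - j) * y') * ?Y b)"
    by (simp add: avg_mult)
  also have "\<dots> \<le> avg (V - B) (\<lambda>b. exp (real m * y') + (\<Sum>i<j. smean V i (?g j i) (insert b B)))"
    by (intro avg_mono Suc.IH)
       (use Suc.prems assms in \<open>auto simp: y'_def card_Diff_insert_eq\<close>)
  also have "\<dots> = exp (real m * y') + (\<Sum>i<j. smean V (Suc i) (?g j i) B)"
    by (simp only: avg_add avg_sum smean.simps avg_const[OF finite_Diff[OF assms(1)] ne])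
  \<comment> \<open>The exponential of a maximum is at most the sum of both. The one at
    \<open>x\<close> becomes the term \<open>i = 0\<close>, and the other terms shift by one
    draw.\<close>
  also have "exp (real m * y') \<le> exp (real m * y) + exp (real m * x)"
    by (simp add: y'_def max_def)
  also have "exp (real m * y) + exp (real m * x) + (\<Sum>i<j. smean V (Suc i) (?g j i) B) =
      exp (real m * y) + (\<Sum>i<Suc j. smean V i (?g (Suc j) i) B)"
    unfolding sum.lessThan_Suc_shift by (simp add: x_def mult.assoc)
  finally show ?case by simp
qed simp

text \<open>The pair attaining the spread varies with \<open>B\<close>, hence a union bound over all
  pairs. Jensen's inequality moves first the square and then the exponential inside the conditional
  mean. The case distinction on \<open>B\<close> prepares the passage to samples avoiding
  \<open>b\<close> and \<open>b'\<close>.\<close>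

lemma exp_spread_le_sum:
  assumes "finite V" "0 \<le> s" "finite B" "card B + j + 2 \<le> card V" "B \<subseteq> V"
  shows "exp (s * (spread V j f B)\<^sup>2) \<le>
    (\<Sum>(b, b')\<in>V \<times> V. if B \<inter> {b, b'} = {}
       then smean (V - {b, b'}) j (\<lambda>S. exp (s * (f (insert b S) - f (insert b' S))\<^sup>2)) B else 0)"
proof -
  have card: "card (V - B) = card V - card B" using assms by (simp add: card_Diff_subset)
  have "V - B \<noteq> {}" using card assms by force
  then obtain b b' where b: "b \<in> V - B" "b' \<in> V - B"
    and eq: "spread V j f B = \<bar>smean V j f (insert b B) - smean V j f (insert b' B)\<bar>"
    using assms by (metis spread_attained)
  let ?\<psi> = "\<lambda>S. f (insert b S) - f (insert b' S)"
  have "V - {b, b'} - B = V - B - {b, b'}" by auto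
  moreover have "card {b, b'} \<le> 2" by (simp add: card_insert_if)
  moreover have "card (V - B) - card {b, b'} \<le> card (V - B - {b, b'})"
    by (rule diff_card_le_card_Diff) simp
  ultimately have j: "j \<le> card (V - {b, b'} - B)" using assms(4) card by simp
  have "spread V j f B \<le> \<bar>smean (V - {b, b'}) j ?\<psi> B\<bar>"
  proof (cases "b = b'")
    case False
    then show ?thesis unfolding eq using b card assms by (intro abs_smean_swap_le) auto
  qed (simp add: eq)
  then have "(spread V j f B)\<^sup>2 \<le> (smean (V - {b, b'}) j ?\<psi> B)\<^sup>2"
    by (metis abs_ge_zero eq power2_abs power_mono)
  also have "\<dots> \<le> smean (V - {b, b'}) j (\<lambda>S. (?\<psi> S)\<^sup>2) B"
    by (rule smean_convex) (use assms convex_power2 j in auto)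
  finally have "exp (s * (spread V j f B)\<^sup>2) \<le> exp (s * smean (V - {b, b'}) j (\<lambda>S. (?\<psi> S)\<^sup>2) B)"
    using assms(2) by (simp add: mult_left_mono)
  also have "\<dots> \<le> smean (V - {b, b'}) j (\<lambda>S. exp (s * (?\<psi> S)\<^sup>2)) B"
    using smean_convex[OF _ convex_on_exp[OF assms(2)] j, of "\<lambda>S. (?\<psi> S)\<^sup>2"] assms by simp
  also have "\<dots> = (case (b, b') of (b, b') \<Rightarrow> if B \<inter> {b, b'} = {}
       then smean (V - {b, b'}) j (\<lambda>S. exp (s * (f (insert b S) - f (insert b' S))\<^sup>2)) B else 0)"
    using b by simp
  also have "\<dots> \<le> (\<Sum>(b, b')\<in>V \<times> V. if B \<inter> {b, b'} = {}
       then smean (V - {b, b'}) j (\<lambda>S. exp (s * (f (insert b S) - f (insert b' S))\<^sup>2)) B else 0)"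
  proof (rule member_le_sum)
    show "0 \<le> (case p of (b, b') \<Rightarrow> if B \<inter> {b, b'} = {}
       then smean (V - {b, b'}) j (\<lambda>S. exp (s * (f (insert b S) - f (insert b' S))\<^sup>2)) B else 0)" for p
      by (auto split: prod.split intro: smean_nonneg)
  qed (use b assms in auto)
  finally show ?thesis .
qed

text \<open>Swapping \<open>b\<close> for \<open>b'\<close> may change \<open>f\<close> a lot, but
  this change is centred and itself Lipschitz, hence subgaussian. This controls the ranges of the
  Doob increments in exponential mean.\<close>

theorem smean_exp_square_le_of_second_difference:
  fixes K m :: nat and f :: "'a set \<Rightarrow> real" and L \<mu> :: real
  defines "\<psi> \<equiv> \<lambda>b b' S. f (insert b S) - f (insert b' S)"
  assumes "finite V" "0 < L" "1 \<le> m" "m < card V" and \<mu>: "\<bar>\<mu>\<bar> = 4 / (L * real m)"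
    and lip: "\<And>b b' S c c'. b \<in> V \<Longrightarrow> b' \<in> V \<Longrightarrow> b \<noteq> b' \<Longrightarrow> S \<subseteq> V - {b, b'} \<Longrightarrow>
       c \<in> V - {b, b'} - S \<Longrightarrow> c' \<in> V - {b, b'} - S \<Longrightarrow> \<bar>\<psi> b b' (insert c S) - \<psi> b b' (insert c' S)\<bar> \<le> L"
    and mean: "\<And>b b'. b \<in> V \<Longrightarrow> b' \<in> V \<Longrightarrow> b \<noteq> b' \<Longrightarrow> smean (V - {b, b'}) (m - 1) (\<psi> b b') {} = 0"
    and bd: "\<And>b b' S. b \<in> V \<Longrightarrow> b' \<in> V \<Longrightarrow> S \<subseteq> V \<Longrightarrow> 4 * \<bar>\<psi> b b' S\<bar> \<le> L * real K"
  shows "(smean V m (\<lambda>S. exp (\<mu> / 2 * f S)) {})\<^sup>2 \<le>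
    exp (\<mu> * smean V m f {}) * (1 + real m * ((real (card V))\<^sup>2 * (2 * (2 * real K + 1))))"
proof -
  \<comment> \<open>This is \<open>m * \<mu>\<^sup>2 / 8\<close>: the factor \<open>m\<close> comes
    from bounding a sum of \<open>m\<close> squared ranges by its largest term, and
    \<open>\<mu>\<close> is such that \<open>s * L\<^sup>2 * m = 2\<close>, within the subgaussian
    limit.\<close>
  define s where "s = 2 / (L\<^sup>2 * real m)"
  define M where "M = 2 * (2 * real K + 1)"
  have s0: "0 \<le> s" unfolding s_def by simp
  have "\<mu>\<^sup>2 = (4 / (L * real m))\<^sup>2" using \<mu> by (metis power2_abs)
  then have \<kappa>: "real m * (\<mu>\<^sup>2 / 8) = s"
    using assms by (simp add: s_def power2_eq_square field_simps)
  \<comment> \<open>The constant \<open>4\<close> is a square, and \<open>sqrt s \<le> 2 / L\<close>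
    turns the bound on \<open>\<psi>\<close> into the grid condition.\<close>
  have "s \<le> 4 / L\<^sup>2" unfolding s_def using assms
    by (simp add: divide_simps)
  then have "sqrt s \<le> sqrt ((2 / L)\<^sup>2)" by (simp add: power_divide)
  then have ss: "sqrt s \<le> 2 / L" using \<open>0 < L\<close> by simp
  have pair: "smean (V - {b, b'}) (m - 1) (\<lambda>S. exp (s * (\<psi> b b' S)\<^sup>2)) {} \<le> M"
    if b: "b \<in> V" "b' \<in> V" for b b'
  proof (cases "b = b'")
    case True
    then have "smean (V - {b, b'}) (m - 1) (\<lambda>S. exp (s * (\<psi> b b' S)\<^sup>2)) {} \<le> 1"
      using smean_const_le[of 1] by (simp add: \<psi>_def)
    then show ?thesis by (simp add: M_def)
  next
    case False
    show ?thesis unfolding M_def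
    proof (rule smean_exp_square_le)
      show "m - 1 \<le> card (V - {b, b'})"
        using assms b False by (simp add: card_Diff_subset)
      show "2 * sqrt s * \<bar>\<psi> b b' S\<bar> \<le> real K" if "S \<subseteq> V - {b, b'}" for S
      proof -
        have "2 * sqrt s * \<bar>\<psi> b b' S\<bar> \<le> 2 * (2 / L) * \<bar>\<psi> b b' S\<bar>"
          by (intro mult_right_mono mult_left_mono ss) auto
        also have "\<dots> \<le> real K" using bd[OF b, of S] that \<open>0 < L\<close> by (auto simp: field_simps)
        finally show ?thesis .
      qed
      show "s * L\<^sup>2 * real (m - 1) \<le> 2"
        using assms(3,4) by (simp add: s_def of_nat_diff field_simps)
      show "\<bar>\<psi> b b' (insert c S) - \<psi> b b' (insert c' S)\<bar> \<le> L"
        if "S \<subseteq> V - {b, b'}" "c \<in> V - {b, b'} - S" "c' \<in> V - {b, b'} - S" for S c c'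
        by (rule lip) (use b False that in auto)
    qed (use assms s0 b False in auto)
  qed
  have level: "smean V i (\<lambda>S. exp (s * (spread V (m - Suc i) f S)\<^sup>2)) {} \<le> (real (card V))\<^sup>2 * M"
    if i: "i < m" for i
  proof -
    \<comment> \<open>Of the \<open>m\<close> draws, \<open>i\<close> precede the spread and one is
      the swapped element. Joining the \<open>i\<close> and \<open>j\<close> draws outside the pair
      gives \<open>m - 1\<close> draws, the number in \<open>pair\<close>.\<close>
    define j where "j = m - Suc i"
    let ?G = "\<lambda>b b'. smean (V - {b, b'}) j (\<lambda>S. exp (s * (\<psi> b b' S)\<^sup>2))"
    have "smean V i (\<lambda>S. exp (s * (spread V j f S)\<^sup>2)) {} \<le>
        smean V i (\<lambda>S. \<Sum>p\<in>V \<times> V. if S \<inter> {fst p, snd p} = {} then ?G (fst p) (snd p) S else 0) {}"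
    proof (rule smean_mono)
      fix S assume S: "{} \<subseteq> S" "S \<subseteq> {} \<union> V" "card S = card {} + i"
      then have "card S + j + 2 \<le> card V" using i assms by (simp add: j_def)
      then show "exp (s * (spread V j f S)\<^sup>2) \<le>
          (\<Sum>p\<in>V \<times> V. if S \<inter> {fst p, snd p} = {} then ?G (fst p) (snd p) S else 0)"
        using exp_spread_le_sum[OF \<open>finite V\<close> s0, of S j f] S \<open>finite V\<close>
        unfolding \<psi>_def by (simp add: case_prod_unfold finite_subset)
    qed (use assms in auto)
    also have "\<dots> = (\<Sum>p\<in>V \<times> V. smean V i (\<lambda>S. if S \<inter> {fst p, snd p} = {} then ?G (fst p) (snd p) S else 0) {})"
      by (rule smean_sum)
    also have "\<dots> \<le> (\<Sum>p\<in>V \<times> V. M)"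
    proof (rule sum_mono)
      fix p assume p: "p \<in> V \<times> V"
      have "smean V i (\<lambda>S. if S \<inter> {fst p, snd p} = {} then ?G (fst p) (snd p) S else 0) {} \<le>
          smean (V - {fst p, snd p}) i (?G (fst p) (snd p)) {}"
        using assms by (intro smean_avoid_le smean_nonneg) auto
      also have "\<dots> = smean (V - {fst p, snd p}) (m - 1) (\<lambda>S. exp (s * (\<psi> (fst p) (snd p) S)\<^sup>2)) {}"
        using i by (simp add: smean_smean j_def)
      also have "\<dots> \<le> M" using p by (intro pair) auto
      finally show "smean V i (\<lambda>S. if S \<inter> {fst p, snd p} = {} then ?G (fst p) (snd p) S else 0) {} \<le> M" .
    qed
    also have "\<dots> = (real (card V))\<^sup>2 * M"
      by (simp add: card_cartesian_product power2_eq_square)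
    finally show ?thesis unfolding j_def .
  qed
  have "spread_mgf V f (\<mu>\<^sup>2 / 8) m {} \<le> 1 + (\<Sum>i<m. smean V i (\<lambda>S. exp (s * (spread V (m - Suc i) f S)\<^sup>2)) {})"
    using spread_mgf_le_sum[of V "\<mu>\<^sup>2 / 8" 0 m m "{}" f] assms by (simp only: \<kappa>) simp
  also have "\<dots> \<le> 1 + (\<Sum>i<m. (real (card V))\<^sup>2 * M)"
    by (intro add_mono sum_mono level) auto
  finally have Y: "spread_mgf V f (\<mu>\<^sup>2 / 8) m {} \<le> 1 + real m * ((real (card V))\<^sup>2 * M)"
    by simp
  have "(smean V m (\<lambda>S. exp (\<mu> / 2 * f S)) {})\<^sup>2 \<le> exp (\<mu> * smean V m f {}) * spread_mgf V f (\<mu>\<^sup>2 / 8) m {}"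
    using assms by (intro smean_exp_square_le_spread_mgf) auto
  also have "\<dots> \<le> exp (\<mu> * smean V m f {}) * (1 + real m * ((real (card V))\<^sup>2 * M))"
    using Y by (intro mult_left_mono) auto
  finally show ?thesis unfolding M_def .
qed

subsection \<open>Arithmetic progressions\<close>

lemma finite_progressions: "finite (progressions N k)"
  and card_progressions_le: "card (progressions N k) \<le> N\<^sup>2"
proof -
  let ?I = "{0..<N} \<times> {1..(N - 1) div 2}"
  have sub: "progressions N k \<subseteq> (\<lambda>(x, d). progression N k x d) ` ?I"
    unfolding progressions_def by auto
  show "finite (progressions N k)" by (rule finite_subset[OF sub]) simp
  have "card (progressions N k) \<le> card ?I" by (rule surj_card_le[OF _ sub]) simp
  also have "\<dots> = N * ((N - 1) div 2)" by (simp add: card_cartesian_product)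
  also have "\<dots> \<le> N * N" by (rule mult_left_mono) auto
  finally show "card (progressions N k) \<le> N\<^sup>2" by (simp add: power2_eq_square)
qed

lemma eq_of_int_dvd_diff:
  fixes a b N :: nat
  assumes "int N dvd int a - int b" "a < N" "b < N"
  shows "a = b"
  using mod_eq_dvd_iff[of "int a" "int N" "int b"] assms by simp

text \<open>Subtracting the congruences makes \<open>N\<close> divide
  \<open>(i - j) * (d - d')\<close>; as \<open>0 < \<bar>i - j\<bar> < N\<close> and
  \<open>N\<close> is prime, the differences agree, and then so do the starting points.\<close>

lemma progression_unique:
  fixes N k i j x x' d d' :: nat
  assumes "prime N" "k \<le> N" "i < k" "j < k" "i \<noteq> j" "x < N" "x' < N" "d < N" "d' < N"
    and "(x + i * d) mod N = (x' + i * d') mod N" "(x + j * d) mod N = (x' + j * d') mod N"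
  shows "x = x' \<and> d = d'"
proof -
  have "int N dvd (int x + int i * int d) - (int x' + int i * int d')"
       "int N dvd (int x + int j * int d) - (int x' + int j * int d')"
    using assms(10,11) by (metis mod_eq_dvd_iff of_nat_add of_nat_mod of_nat_mult)+
  then have i: "int N dvd (int x - int x') + int i * (int d - int d')"
    and j: "int N dvd (int x - int x') + int j * (int d - int d')"
    by (simp_all add: algebra_simps)
  have "int N dvd (int i - int j) * (int d - int d')"
    using dvd_diff[OF i j] by (simp add: algebra_simps)
  then have "int N dvd int i - int j \<or> int N dvd int d - int d'"
    using assms(1) by (simp add: prime_dvd_mult_iff)
  moreover have "\<not> int N dvd int i - int j"
    using eq_of_int_dvd_diff[of N i j] assms(2-5) by linarith
  ultimately have "int N dvd int d - int d'" by simp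
  then have d: "d = d'" using assms(8,9) by (rule eq_of_int_dvd_diff)
  then have "int N dvd int x - int x'" using i by simp
  then have "x = x'" using assms(6,7) by (rule eq_of_int_dvd_diff)
  then show ?thesis using d by simp
qed

text \<open>The positions \<open>i\<close>, \<open>j\<close> of \<open>u\<close> and
  \<open>v\<close> determine the progression, and there are \<open>k\<^sup>2\<close> pairs of
  positions.\<close>

lemma card_progressions_through_pair_le:
  assumes "prime N" "k \<le> N" "u \<noteq> v"
  shows "card {P \<in> progressions N k. u \<in> P \<and> v \<in> P} \<le> k\<^sup>2"
proof -
  define A where "A = (\<lambda>(i, j). {progression N k x d | x d. x < N \<and> d < N \<and>
    (x + i * d) mod N = u \<and> (x + j * d) mod N = v})"
  have A1: "finite (A p) \<and> card (A p) \<le> 1" if "p \<in> {0..<k} \<times> {0..<k}" for p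
  proof -
    obtain i j where p: "p = (i, j)" by fastforce
    have "P = Q" if PQ_in: "P \<in> A p" "Q \<in> A p" for P Q
    proof -
      obtain x d x' d' where PQ: "P = progression N k x d" "Q = progression N k x' d'"
        and *: "x < N" "d < N" "x' < N" "d' < N"
        and u: "(x + i * d) mod N = u" "(x' + i * d') mod N = u"
        and v: "(x + j * d) mod N = v" "(x' + j * d') mod N = v"
        using PQ_in by (auto simp: A_def p)
      have "i \<noteq> j" using u v assms(3) by auto
      then have "x = x' \<and> d = d'"
        using progression_unique[of N k i j x x' d d'] assms * u v \<open>p \<in> _\<close> p by auto
      then show ?thesis using PQ by simp
    qed
    then have "A p = {} \<or> (\<exists>P. A p = {P})" by blast
    then show ?thesis by auto
  qed
  have sub: "{P \<in> progressions N k. u \<in> P \<and> v \<in> P} \<subseteq> (\<Union>p\<in>{0..<k} \<times> {0..<k}. A p)"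
  proof
    fix P assume "P \<in> {P \<in> progressions N k. u \<in> P \<and> v \<in> P}"
    then obtain x d where xd: "x < N" "1 \<le> d" "d \<le> (N - 1) div 2" "P = progression N k x d" "u \<in> P" "v \<in> P"
      unfolding progressions_def by auto
    then obtain i j where ij: "i < k" "j < k" "u = (x + i * d) mod N" "v = (x + j * d) mod N"
      unfolding progression_def by auto
    have "d < N" using xd by linarith
    then have "P \<in> A (i, j)" using xd ij by (auto simp: A_def)
    then show "P \<in> (\<Union>p\<in>{0..<k} \<times> {0..<k}. A p)" using ij by force
  qed
  have "card {P \<in> progressions N k. u \<in> P \<and> v \<in> P} \<le> card (\<Union>p\<in>{0..<k} \<times> {0..<k}. A p)"
    using A1 by (intro card_mono sub) auto
  also have "\<dots> \<le> (\<Sum>p\<in>{0..<k} \<times> {0..<k}. card (A p))"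
    by (rule card_UN_le) simp
  also have "\<dots> \<le> (\<Sum>p\<in>{0..<k} \<times> {0..<k}. 1)"
    using A1 by (intro sum_mono) auto
  also have "\<dots> = k\<^sup>2" by (simp add: power2_eq_square)
  finally show ?thesis .
qed

lemma num_progressions_eq_sum:
  "real (num_progressions N k S) = (\<Sum>P\<in>progressions N k. of_bool (P \<subseteq> S))"
  unfolding num_progressions_def using finite_progressions
  by (simp add: of_bool_def sum.If_cases Int_def)

lemma num_progressions_le: "num_progressions N k S \<le> N\<^sup>2"
  unfolding num_progressions_def
  using card_mono[OF finite_progressions, of "{P \<in> progressions N k. P \<subseteq> S}" N k] card_progressions_le[of N k]
  by auto

text \<open>Inclusion--exclusion leaves exactly the progressions inside
  \<open>insert b (insert c S)\<close> that pass through both \<open>b\<close> and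
  \<open>c\<close>.\<close>

lemma num_progressions_mixed_difference:
  assumes "prime N" "k \<le> N" "b \<noteq> c" "b \<notin> S" "c \<notin> S"
  defines "f \<equiv> \<lambda>S. real (num_progressions N k S)"
  shows "f (insert b (insert c S)) - f (insert b S) - f (insert c S) + f S \<in> {0..(real k)\<^sup>2}"
proof -
  let ?A = "{P \<in> progressions N k. P \<subseteq> insert b (insert c S) \<and> b \<in> P \<and> c \<in> P}"
  have "f (insert b (insert c S)) - f (insert b S) - f (insert c S) + f S =
      (\<Sum>P\<in>progressions N k. of_bool (P \<subseteq> insert b (insert c S)) - of_bool (P \<subseteq> insert b S)
         - of_bool (P \<subseteq> insert c S) + of_bool (P \<subseteq> S))"
    unfolding f_def num_progressions_eq_sum by (simp add: sum.distrib sum_subtractf)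
  also have "\<dots> = (\<Sum>P\<in>progressions N k. of_bool (P \<subseteq> insert b (insert c S) \<and> b \<in> P \<and> c \<in> P))"
  proof (rule sum.cong)
    fix P
    have "P \<subseteq> insert b S \<longleftrightarrow> P \<subseteq> insert b (insert c S) \<and> c \<notin> P"
         "P \<subseteq> insert c S \<longleftrightarrow> P \<subseteq> insert b (insert c S) \<and> b \<notin> P"
         "P \<subseteq> S \<longleftrightarrow> P \<subseteq> insert b (insert c S) \<and> b \<notin> P \<and> c \<notin> P"
      using assms by auto
    then show "of_bool (P \<subseteq> insert b (insert c S)) - of_bool (P \<subseteq> insert b S)
         - of_bool (P \<subseteq> insert c S) + of_bool (P \<subseteq> S) =
         (of_bool (P \<subseteq> insert b (insert c S) \<and> b \<in> P \<and> c \<in> P) :: real)"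
      by (auto simp: of_bool_def)
  qed simp
  also have "\<dots> = real (card ?A)"
    using finite_progressions by (simp add: of_bool_def sum.If_cases Int_def)
  finally have eq: "f (insert b (insert c S)) - f (insert b S) - f (insert c S) + f S = real (card ?A)" .
  have "card ?A \<le> card {P \<in> progressions N k. b \<in> P \<and> c \<in> P}"
    by (rule card_mono) (use finite_progressions in auto)
  also have "\<dots> \<le> k\<^sup>2" using assms by (intro card_progressions_through_pair_le)
  finally show ?thesis unfolding eq by (simp flip: of_nat_power)
qed

text \<open>The expression is an alternating sum of four mixed differences, two with each sign, all
  in \<open>{0..(real k)\<^sup>2}\<close>.\<close>

lemma num_progressions_swap_Lipschitz:
  assumes "prime N" "k \<le> N" "{b, b'} \<inter> {c, c'} = {}" "S \<inter> {b, b', c, c'} = {}"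
  defines "f \<equiv> \<lambda>S. real (num_progressions N k S)"
  shows "\<bar>(f (insert b (insert c S)) - f (insert b' (insert c S))) -
          (f (insert b (insert c' S)) - f (insert b' (insert c' S)))\<bar> \<le> 2 * (real k)\<^sup>2"
proof -
  have *: "f (insert x (insert y S)) - f (insert x S) - f (insert y S) + f S \<in> {0..(real k)\<^sup>2}"
    if "x \<in> {b, b'}" "y \<in> {c, c'}" for x y
    unfolding f_def by (rule num_progressions_mixed_difference) (use assms that in auto)
  show ?thesis
    using *[of b c] *[of b' c] *[of b c'] *[of b' c'] by (simp add: abs_le_iff)
qed

section \<open>Reflection symmetry\<close>

text \<open>The map \<open>y \<mapsto> s - y\<close> modulo \<open>N\<close>, computed in the
  integers because subtraction of naturals truncates.\<close>

definition reflection :: "nat \<Rightarrow> nat \<Rightarrow> nat \<Rightarrow> nat" where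
  "reflection N s y = nat ((int s - int y) mod int N)"

lemma reflection_less: "0 < N \<Longrightarrow> reflection N s y < N"
  by (simp add: reflection_def nat_less_iff)

lemma reflection_reflection: "y < N \<Longrightarrow> reflection N s (reflection N s y) = y"
  by (simp add: reflection_def mod_diff_right_eq)

lemma inj_on_reflection: "inj_on (reflection N s) {0..<N}"
  by (rule inj_on_inverseI[of _ "reflection N s"]) (simp add: reflection_reflection)

text \<open>Read backwards, the reflected progression has the same difference \<open>d\<close>, so
  the range allowed for \<open>d\<close> is respected.\<close>

lemma reflection_progression:
  assumes "P \<in> progressions N k"
  shows "reflection N s ` P \<in> progressions N k"
proof -
  obtain x d where xd: "x < N" "1 \<le> d" "d \<le> (N - 1) div 2" and P: "P = progression N k x d"
    using assms unfolding progressions_def by auto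
  \<comment> \<open>The reflection of the last term \<open>x + (k - 1) * d\<close>.\<close>
  define z where "z = nat ((int s - int x - int (k - 1) * int d) mod int N)"
  have z: "z < N" using xd by (simp add: z_def nat_less_iff)
  have "reflection N s ((x + i * d) mod N) = (z + (k - 1 - i) * d) mod N" if "i < k" for i
  proof -
    have "int ((z + (k - 1 - i) * d) mod N) = (int s - int x - int (k - 1) * int d + int (k - 1 - i) * int d) mod int N"
      using xd by (simp add: z_def of_nat_mod mod_add_left_eq)
    also have "int s - int x - int (k - 1) * int d + int (k - 1 - i) * int d = int s - (int x + int i * int d)"
      using that by (simp add: of_nat_diff algebra_simps)
    also have "\<dots> mod int N = int (reflection N s ((x + i * d) mod N))"
      using xd by (simp add: reflection_def of_nat_mod mod_diff_right_eq)
    finally show ?thesis by linarith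
  qed
  then have "reflection N s ` P = (\<lambda>i. (z + (k - 1 - i) * d) mod N) ` {0..<k}"
    unfolding P progression_def image_image by (intro image_cong) auto
  also have "\<dots> = (\<lambda>i. (z + i * d) mod N) ` (\<lambda>i. k - 1 - i) ` {0..<k}"
    by (simp add: image_image)
  also have "(\<lambda>i. k - 1 - i) ` {0..<k} = {0..<k}"
  proof (intro equalityI subsetI)
    fix i assume "i \<in> {0..<k}"
    then show "i \<in> (\<lambda>i. k - 1 - i) ` {0..<k}" by (intro image_eqI[of _ _ "k - 1 - i"]) auto
  qed auto
  finally have "reflection N s ` P = progression N k z d" by (simp add: progression_def)
  then show ?thesis using z xd unfolding progressions_def by auto
qed

text \<open>The reflection maps progressions in \<open>S\<close> injectively to progressions in the
  image; being an involution, it gives the reverse inequality too.\<close>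

lemma num_progressions_reflection:
  assumes "S \<subseteq> {0..<N}"
  shows "num_progressions N k (reflection N s ` S) = num_progressions N k S"
proof -
  have le: "num_progressions N k S \<le> num_progressions N k (reflection N s ` S)" if "S \<subseteq> {0..<N}" for S
    unfolding num_progressions_def
  proof (rule card_inj_on_le)
    show "inj_on ((`) (reflection N s)) {P \<in> progressions N k. P \<subseteq> S}"
    proof (rule inj_onI)
      fix P Q assume "P \<in> {P \<in> progressions N k. P \<subseteq> S}" "Q \<in> {P \<in> progressions N k. P \<subseteq> S}"
      then have "P \<subseteq> {0..<N}" "Q \<subseteq> {0..<N}" using that by auto
      moreover assume "reflection N s ` P = reflection N s ` Q"
      ultimately show "P = Q"
        using inj_on_image_eq_iff[of "reflection N s" "{0..<N}" P Q] inj_on_reflection by simp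
    qed
  qed (use reflection_progression finite_progressions in auto)
  have "reflection N s ` reflection N s ` S = S"
    unfolding image_image using assms reflection_reflection[of _ N s] by (auto simp: subset_iff image_iff)
  moreover have "reflection N s ` S \<subseteq> {0..<N}"
  proof (rule image_subsetI)
    fix y assume "y \<in> S"
    then have "y < N" using assms by auto
    then show "reflection N s y \<in> {0..<N}" by (simp add: reflection_less)
  qed
  ultimately show ?thesis using le[OF assms] le[of "reflection N s ` S"] by auto
qed

text \<open>The reflection with \<open>s = b + b'\<close> exchanges the two points, permutes the
  rest and preserves \<open>f\<close>. It negates the integrand, so the mean equals its own
  negative.\<close>

lemma smean_num_progressions_swap_eq_0:
  fixes N k j b b' :: nat
  assumes "b < N" "b' < N"
  defines "f \<equiv> \<lambda>S. real (num_progressions N k S)"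
  shows "smean ({0..<N} - {b, b'}) j (\<lambda>S. f (insert b S) - f (insert b' S)) {} = 0"
proof -
  define V where "V = {0..<N} - {b, b'}"
  define r where "r = reflection N (b + b')"
  let ?\<psi> = "\<lambda>S. f (insert b S) - f (insert b' S)"
  have rb: "r b = b'" "r b' = b" using assms by (simp_all add: r_def reflection_def)
  have rr: "r (r y) = y" if "y < N" for y using that by (simp add: r_def reflection_reflection)
  have rl: "r y < N" for y using assms by (simp add: r_def reflection_less)
  have inj: "inj_on r V"
    unfolding r_def V_def by (rule inj_on_subset[OF inj_on_reflection]) auto
  have sub: "r ` V \<subseteq> V"
  proof
    fix y assume "y \<in> r ` V"
    then obtain x where "y = r x" "x \<in> V" by (rule imageE)
    then have x: "y = r x" "x < N" "x \<noteq> b" "x \<noteq> b'" by (auto simp: V_def)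
    then have "r y = x" by (simp add: rr)
    then have "y \<noteq> b" "y \<noteq> b'" using x rb by metis+
    then show "y \<in> V" using x(1) rl by (simp add: V_def)
  qed
  moreover have "V \<subseteq> r ` V"
  proof
    fix y assume y: "y \<in> V"
    then have "r y \<in> V" using sub by auto
    moreover have "y = r (r y)" using y by (simp add: rr V_def)
    ultimately show "y \<in> r ` V" by blast
  qed
  ultimately have rV: "r ` V = V" by auto
  have inv: "f (r ` S) = f S" if "S \<subseteq> {0..<N}" for S
    unfolding f_def r_def using num_progressions_reflection[OF that] by simp
  have "smean V j ?\<psi> {} = smean V j (\<lambda>S. ?\<psi> (r ` S)) {}"
    using smean_image[OF inj, of "{}" j ?\<psi>] by (simp add: rV)
  also have "\<dots> = smean V j (\<lambda>S. (-1) * ?\<psi> S) {}"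
  proof (rule smean_cong)
    fix S assume "{} \<subseteq> S" "S \<subseteq> {} \<union> V"
    then have S: "insert b S \<subseteq> {0..<N}" "insert b' S \<subseteq> {0..<N}" using assms by (auto simp: V_def)
    show "?\<psi> (r ` S) = (-1) * ?\<psi> S"
      using inv[OF S(1)] inv[OF S(2)] by (simp add: rb)
  qed (auto simp: V_def)
  also have "\<dots> = - smean V j ?\<psi> {}" by (subst smean_mult) simp
  finally show ?thesis unfolding V_def by simp
qed

section \<open>The tail bound\<close>

text \<open>With \<open>x = m\<close> and \<open>n = N\<close> this bounds the factor of the
  exponential moment for \<open>K = N\<^sup>2\<close> by a perfect square.\<close>

lemma polynomial_bound:
  fixes x n :: real
  assumes "0 \<le> x" "x \<le> n" "4 \<le> n"
  shows "1 + x * (n\<^sup>2 * (2 * (2 * n\<^sup>2 + 1))) \<le> n ^ 8"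
proof -
  have n2: "4\<^sup>2 \<le> n\<^sup>2" using assms by (intro power_mono) auto
  then have "2 * (2 * n\<^sup>2 + 1) \<le> 16 * n\<^sup>2" by simp
  also have "\<dots> \<le> n\<^sup>2 * n\<^sup>2" using n2 by (intro mult_right_mono) auto
  finally have "x * (n\<^sup>2 * (2 * (2 * n\<^sup>2 + 1))) \<le> n * (n\<^sup>2 * (n\<^sup>2 * n\<^sup>2))"
    by (rule mult_mono[OF assms(2) mult_left_mono]) (use assms in auto)
  also have "\<dots> = n ^ 7" by (simp add: eval_nat_numeral)
  finally have "1 + x * (n\<^sup>2 * (2 * (2 * n\<^sup>2 + 1))) \<le> n ^ 7 + n ^ 7"
    using one_le_power[of n 7] assms by linarith
  also have "\<dots> = 2 * n ^ 7" by simp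
  also have "\<dots> \<le> n * n ^ 7" using assms by (intro mult_right_mono) auto
  also have "\<dots> = n ^ 8" by (simp add: eval_nat_numeral)
  finally show ?thesis .
qed

theorem theorem5p1:
  fixes k :: nat
  assumes "k \<ge> 3"
  shows "\<exists>c1 c2 :: real. c1 > 0 \<and> c2 > 0 \<and>
           (\<forall>(N::nat) (m::nat) (a::real).
              prime N \<and> N > k \<and> 1 \<le> m \<and> m \<le> N \<and> a > 0 \<longrightarrow>
              measure_pmf.prob (random_subset N m) {B. \<bar>deviation N k m B\<bar> > a}
                \<le> real N powr c1 * exp (- c2 * (a / real m)))"
proof -
  have "measure_pmf.prob (random_subset N m) {B. \<bar>deviation N k m B\<bar> > a}
      \<le> real N powr 5 * exp (- (1 / (real k)\<^sup>2) * (a / real m))"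
    if "prime N" "N > k" "1 \<le> m" "m \<le> N" "a > 0" for N m a
  proof (cases "m = N")
    case True
    \<comment> \<open>The only sample is the whole of \<open>{0..<N}\<close>, so the deviation
      vanishes; the general estimate requires \<open>m < card V\<close>.\<close>
    have "{B. B \<subseteq> {0..<N} \<and> card B = N} = {{0..<N}}"
      using card_subset_eq[of "{0..<N}"] by auto
    then have "random_subset N m = return_pmf {0..<N}"
      by (simp add: random_subset_def True pmf_of_set_singleton)
    then show ?thesis using that by (simp add: deviation_def)
  next
    case False
    define V where "V = {0..<N}"
    define f where "f = (\<lambda>S. real (num_progressions N k S))"
    define L where "L = 2 * (real k)\<^sup>2"
    \<comment> \<open>With \<open>L = 2 * k\<^sup>2\<close> this makes
      \<open>\<mu> / 2 = 1 / (k\<^sup>2 * m)\<close>, whence the constant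
      \<open>1 / k\<^sup>2\<close> in the exponent.\<close>
    define \<mu> where "\<mu> = 4 / (L * real m)"
    define F where "F = smean V m f {}"
    have V: "finite V" "card V = N" by (simp_all add: V_def)
    have N4: "4 \<le> N" and m: "m < N" using that assms False by auto
    have k9: "3\<^sup>2 \<le> (real k)\<^sup>2" using assms by (intro power_mono) auto
    then have L: "4 \<le> L" by (simp add: L_def)
    have expect: "measure_pmf.expectation (random_subset N m) g = smean V m g {}" for g
      unfolding random_subset_def V_def using that by (intro expectation_subsets_eq_smean) auto
    \<comment> \<open>Both signs of \<open>\<nu>\<close> occur, one for each tail.\<close>
    have mgf: "smean V m (\<lambda>S. exp (\<nu> / 2 * f S)) {} \<le> real N ^ 4 * exp (\<nu> / 2 * F)"
      if \<nu>: "\<bar>\<nu>\<bar> = \<mu>" for \<nu>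
    proof -
      have "(smean V m (\<lambda>S. exp (\<nu> / 2 * f S)) {})\<^sup>2 \<le>
          exp (\<nu> * F) * (1 + real m * ((real (card V))\<^sup>2 * (2 * (2 * real (N\<^sup>2) + 1))))"
        unfolding F_def
      proof (rule smean_exp_square_le_of_second_difference)
        show "\<bar>f (insert b (insert c S)) - f (insert b' (insert c S)) -
            (f (insert b (insert c' S)) - f (insert b' (insert c' S)))\<bar> \<le> L"
          if "S \<subseteq> V - {b, b'}" "c \<in> V - {b, b'} - S" "c' \<in> V - {b, b'} - S" for b b' S c c'
          unfolding f_def L_def using \<open>prime N\<close> \<open>N > k\<close> that
          by (intro num_progressions_swap_Lipschitz) auto
        show "smean (V - {b, b'}) (m - 1) (\<lambda>S. f (insert b S) - f (insert b' S)) {} = 0"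
          if "b \<in> V" "b' \<in> V" for b b'
          unfolding f_def V_def using that by (intro smean_num_progressions_swap_eq_0) (auto simp: V_def)
        \<comment> \<open>The grid size \<open>K = N\<^sup>2\<close> suffices, since counts lie
          between \<open>0\<close> and \<open>N\<^sup>2\<close> and
          \<open>L \<ge> 4\<close>.\<close>
        show "4 * \<bar>f (insert b S) - f (insert b' S)\<bar> \<le> L * real (N\<^sup>2)" for b b' S
        proof (rule mult_mono)
          show "\<bar>f (insert b S) - f (insert b' S)\<bar> \<le> real (N\<^sup>2)"
            using num_progressions_le[of N k "insert b S"] num_progressions_le[of N k "insert b' S"]
            unfolding f_def by linarith
        qed (use L in auto)
      qed (use V m L that \<open>1 \<le> m\<close> \<mu>_def in auto)
      also have "\<dots> \<le> exp (\<nu> * F) * (real N ^ 8)"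
        using polynomial_bound[of "real m" "real N"] m N4 by (intro mult_left_mono) (simp_all add: V)
      also have "\<dots> = (real N ^ 4 * exp (\<nu> / 2 * F))\<^sup>2"
        by (simp add: power_mult_distrib flip: exp_double)
      finally show ?thesis by (rule power2_le_imp_le) simp
    qed
    let ?bad = "{B. \<bar>deviation N k m B\<bar> > a}"
    have \<mu>0: "0 < \<mu>" using L that by (simp add: \<mu>_def)
    have dev: "deviation N k m S = f S - F" for S
      unfolding deviation_def expect F_def f_def by simp
    \<comment> \<open>Markov's inequality for both tails in pointwise form: a bad \<open>S\<close>
      makes one of the two exponentials at least \<open>1\<close>.\<close>
    have pw: "indicator ?bad S \<le> exp (- \<mu> / 2 * (a + F)) * exp (\<mu> / 2 * f S) +
        exp (- \<mu> / 2 * (a - F)) * exp (- \<mu> / 2 * f S)" for S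
    proof -
      define E1 where "E1 = exp (\<mu> / 2 * (f S - F - a))"
      define E2 where "E2 = exp (\<mu> / 2 * (F - f S - a))"
      have "0 \<le> E1" "0 \<le> E2" by (simp_all add: E1_def E2_def)
      moreover have "1 \<le> E1" if "a < f S - F" using that \<mu>0 by (simp add: E1_def)
      moreover have "1 \<le> E2" if "a < F - f S" using that \<mu>0 by (simp add: E2_def)
      moreover have "a < f S - F \<or> a < F - f S" if "S \<in> ?bad"
        using that unfolding mem_Collect_eq dev by linarith
      ultimately have "indicator ?bad S \<le> E1 + E2"
        by (cases "S \<in> ?bad") auto
      also have "E1 + E2 = exp (- \<mu> / 2 * (a + F)) * exp (\<mu> / 2 * f S) +
          exp (- \<mu> / 2 * (a - F)) * exp (- \<mu> / 2 * f S)"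
        unfolding E1_def E2_def exp_add[symmetric] by (simp add: field_simps)
      finally show ?thesis .
    qed
    have "measure_pmf.prob (random_subset N m) ?bad = smean V m (indicator ?bad) {}"
      unfolding expect[symmetric] by simp
    also have "\<dots> \<le> smean V m (\<lambda>S. exp (- \<mu> / 2 * (a + F)) * exp (\<mu> / 2 * f S) +
        exp (- \<mu> / 2 * (a - F)) * exp (- \<mu> / 2 * f S)) {}"
      by (rule smean_mono) (use V pw in auto)
    also have "\<dots> = exp (- \<mu> / 2 * (a + F)) * smean V m (\<lambda>S. exp (\<mu> / 2 * f S)) {} +
        exp (- \<mu> / 2 * (a - F)) * smean V m (\<lambda>S. exp (- \<mu> / 2 * f S)) {}"
      by (simp only: smean_add smean_mult)
    also have "\<dots> \<le> exp (- \<mu> / 2 * (a + F)) * (real N ^ 4 * exp (\<mu> / 2 * F)) +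
        exp (- \<mu> / 2 * (a - F)) * (real N ^ 4 * exp (- \<mu> / 2 * F))"
      using \<mu>0 by (intro add_mono mult_left_mono mgf) auto
    also have "\<dots> = 2 * real N ^ 4 * exp (- (\<mu> / 2) * a)"
      unfolding mult.left_commute[of _ "real N ^ 4"] exp_add[symmetric] by (simp add: field_simps)
    \<comment> \<open>The factor \<open>2\<close> from the two tails is absorbed by one more factor
      \<open>N\<close>.\<close>
    also have "\<dots> \<le> real N ^ 5 * exp (- (\<mu> / 2) * a)"
      using N4 by (intro mult_right_mono) (auto simp: eval_nat_numeral)
    also have "\<mu> / 2 = 1 / (real k)\<^sup>2 / real m"
      by (simp add: \<mu>_def L_def)
    also have "real N ^ 5 = real N powr 5"
      using N4 by (simp add: powr_numeral)
    finally show ?thesis by simp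
  qed
  then show ?thesis
    using assms by (intro exI[of _ 5] exI[of _ "1 / (real k)\<^sup>2"]) auto
qed

end
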